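(* Let $\Omega\subset\mathbb{R}^d$ be a bounded Lipschitz domain, $d\ge2$, $k\in\mathbb{N}_+$, and $m$ an integer with $0\le m\le k$. There exist an integer $J=J(d,k,\Omega)$, fixed parameters $(\omega_j,b_j)\in\mathbb{S}^{d-1}\times[b_-,b_+]$, $1\le j\le J$, and a bounded linear map $$T:\Pi_k\to\mathbb{R}^J,\qquad T(P)=(c_1(P),\ldots,c_J(P)),$$ such that for every $P\in\Pi_k$, $$P(x)=\sum_{j=1}^J c_j(P)\,(\omega_j\cdot x-b_j)_+^k,\qquad x\in\Omega,$$ and $$\sum_{j=1}^J|c_j(P)|\lesssim\|P\|_{H^m(\Omega)},$$ with implicit constant independent of $P$.
   Context: $(t)_+=\max\{t,0\}$. $\Pi_k$ is the space of real polynomials on $\mathbb{R}^d$ of total degree at most $k$. $\|f\|_{H^m(\Omega)}^2=\sum_{|\alpha|\le m}\|D^\alpha f\|_{L^2(\Omega)}^2$. The reals $b_-,b_+$ are fixed with $b_-<\inf_{x\in\Omega,|\omega|=1}\omega\cdot x-1$ and $b_+>\sup_{x\in\Omega,|\omega|=1}\omega\cdot x+1$. *)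

theory Defs
  imports "HOL-Analysis.Analysis"
begin

text \<open>
  Near every boundary point the domain is, in a suitable orthogonal coordinate system, the part
  of a ball above the graph of a Lipschitz function: \<open>e\<close> is the vertical direction, and the graph
  function lives on the hyperplane orthogonal to \<open>e\<close>, on which \<open>x - (e \<bullet> x) *\<^sub>R e\<close> is the orthogonal
  projection of \<open>x\<close>.
\<close>
definition bounded_lipschitz_domain :: "'a::euclidean_space set \<Rightarrow> bool" where
  "bounded_lipschitz_domain \<Omega> \<longleftrightarrow>
     \<Omega> \<noteq> {} \<and> open \<Omega> \<and> connected \<Omega> \<and> bounded \<Omega> \<and>
     (\<forall>p\<in>frontier \<Omega>. \<exists>r>0. \<exists>e \<phi> L. norm e = 1 \<and> L-lipschitz_on {y. e \<bullet> y = 0} \<phi> \<and>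
        \<Omega> \<inter> ball p r = {x \<in> ball p r. e \<bullet> x > \<phi> (x - (e \<bullet> x) *\<^sub>R e)})"

definition multi_indices :: "nat \<Rightarrow> ('n::finite \<Rightarrow> nat) set" where
  "multi_indices m = {\<alpha>. (\<Sum>i\<in>UNIV. \<alpha> i) \<le> m}"

lemma finite_multi_indices: "finite (multi_indices m :: ('n::finite \<Rightarrow> nat) set)"
proof (rule finite_subset)
  show "(multi_indices m :: ('n \<Rightarrow> nat) set) \<subseteq> PiE UNIV (\<lambda>_. {..m})"
  proof
    fix \<alpha> :: "'n \<Rightarrow> nat"
    assume "\<alpha> \<in> multi_indices m"
    then have "\<alpha> i \<le> m" for i
      using member_le_sum[of i UNIV \<alpha>] by (simp add: multi_indices_def)
    then show "\<alpha> \<in> PiE UNIV (\<lambda>_. {..m})" by (simp add: PiE_def Pi_def)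
  qed
qed (rule finite_PiE; simp)

text \<open>
  Polynomials are represented by the functions they induce; over the reals this representation
  is faithful.
\<close>
definition poly_space :: "nat \<Rightarrow> (real^'n \<Rightarrow> real) set" where
  "poly_space k =
     {P. \<exists>a. \<forall>x. P x = (\<Sum>\<alpha>\<in>multi_indices k. a \<alpha> * (\<Prod>i\<in>UNIV. (x $ i) ^ \<alpha> i))}"

definition partial_deriv :: "'n \<Rightarrow> (real^'n \<Rightarrow> real) \<Rightarrow> real^'n \<Rightarrow> real" where
  "partial_deriv i f x = deriv (\<lambda>t. f (x + t *\<^sub>R axis i 1)) 0"

text \<open>
  The index type carries no order, so an enumeration of the coordinates is chosen. For smooth
  functions the iterated derivative below does not depend on this choice, as partial
  derivatives commute.
\<close>
definition coords :: "'n::finite list" where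
  "coords = (SOME xs. set xs = UNIV \<and> distinct xs)"

lemma coords: "set (coords :: 'n::finite list) = UNIV" "distinct (coords :: 'n list)"
proof -
  have "\<exists>xs :: 'n list. set xs = UNIV \<and> distinct xs"
    by (rule finite_distinct_list) simp
  from someI_ex[OF this]
  show "set (coords :: 'n list) = UNIV" "distinct (coords :: 'n list)"
    by (simp_all add: coords_def)
qed

definition multi_deriv :: "('n \<Rightarrow> nat) \<Rightarrow> (real^'n \<Rightarrow> real) \<Rightarrow> real^'n \<Rightarrow> real" where
  "multi_deriv \<alpha> f = foldr (\<lambda>i. partial_deriv i ^^ \<alpha> i) coords f"

text \<open>
  The derivatives are classical ones. This is the Sobolev norm for functions that are smooth in
  a neighbourhood of the closure of a bounded \<open>\<Omega>\<close>, polynomials in particular; for less regular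
  functions weak derivatives would be needed.
\<close>
definition sobolev_norm :: "nat \<Rightarrow> (real^'n) set \<Rightarrow> (real^'n \<Rightarrow> real) \<Rightarrow> real" where
  "sobolev_norm m \<Omega> f =
     sqrt (\<Sum>\<alpha>\<in>multi_indices m. LINT x:\<Omega>|lborel. \<bar>multi_deriv \<alpha> f x\<bar>\<^sup>2)"

definition linear_on_polys :: "nat \<Rightarrow> nat \<Rightarrow> ((real^'n \<Rightarrow> real) \<Rightarrow> nat \<Rightarrow> real) \<Rightarrow> bool" where
  "linear_on_polys k J T \<longleftrightarrow>
     (\<forall>P\<in>poly_space k. \<forall>Q\<in>poly_space k. \<forall>j\<in>{1..J}.
        T (\<lambda>x. P x + Q x) j = T P j + T Q j) \<and>
     (\<forall>P\<in>poly_space k. \<forall>s. \<forall>j\<in>{1..J}. T (\<lambda>x. s * P x) j = s * T P j)"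

definition relu_pow :: "nat \<Rightarrow> real \<Rightarrow> real" where
  "relu_pow k t = (max t 0) ^ k"

end

theory Submission
  imports Defs "HOL-Computational_Algebra.Polynomial"
begin

text \<open>
  Take \<open>k + 1\<close> distinct offsets in \<open>[b_-, b_- + 1]\<close>, so that the truncation is inactive on \<open>\<Omega>\<close>
  and the neurons are the ridge powers \<open>(\<omega> \<bullet> x - b) ^ k\<close>. Lagrange interpolation at the offsets
  produces every \<open>(\<omega> \<bullet> x) ^ l\<close> with \<open>l \<le> k\<close>, and the polarization identity, with directions
  the normalized multi-indices of order at most \<open>k\<close>, then produces all monomials. Hence a fixed
  linear map turns the coefficients of a polynomial into those of the network. The coefficients
  themselves are controlled by the \<open>L\<^sup>2\<close> norm on \<open>\<Omega>\<close>, since the Gram form of the monomials is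
  positive on the compact \<open>l\<^sup>1\<close> unit sphere, and the \<open>L\<^sup>2\<close> norm is at most the \<open>H\<^sup>m\<close> norm.
\<close>

section \<open>Combinations over an indexed family of functions\<close>

text \<open>Coefficients are attached to indices and not to functions, because the family of neurons
  used later may list a function twice: proportional multi-indices normalize to the same
  direction.\<close>

definition spanned_by :: "'i set \<Rightarrow> ('i \<Rightarrow> 'a \<Rightarrow> real) \<Rightarrow> ('a \<Rightarrow> real) set" where
  "spanned_by I g = {f. \<exists>c. \<forall>x. f x = (\<Sum>i\<in>I. c i * g i x)}"

lemma spanned_byI:
  assumes "\<And>x. f x = (\<Sum>i\<in>I. c i * g i x)"
  shows "f \<in> spanned_by I g"
  using assms unfolding spanned_by_def by auto

lemma poly_space_eq_spanned_by:
  "poly_space k = spanned_by (multi_indices k) (\<lambda>\<alpha> x. \<Prod>i\<in>UNIV. (x $ i) ^ \<alpha> i)"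
  by (simp add: poly_space_def spanned_by_def)

lemma spanned_by_generator:
  assumes "finite I" "i \<in> I"
  shows "g i \<in> spanned_by I g"
proof -
  have "g i x = (\<Sum>j\<in>I. of_bool (j = i) * g j x)" for x
    using assms by (simp add: Int_def conj_commute[of "_ \<in> I"] cong: conj_cong)
  then show ?thesis by (rule spanned_byI)
qed

lemma spanned_by_scale:
  assumes "f \<in> spanned_by I g"
  shows "(\<lambda>x. s * f x) \<in> spanned_by I g"
proof -
  from assms obtain c where "\<And>x. f x = (\<Sum>i\<in>I. c i * g i x)"
    unfolding spanned_by_def by auto
  then have "s * f x = (\<Sum>i\<in>I. (s * c i) * g i x)" for x
    by (simp add: sum_distrib_left mult.assoc)
  then show ?thesis by (rule spanned_byI)
qed

lemma spanned_by_sum: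
  assumes "\<And>j. j \<in> J \<Longrightarrow> f j \<in> spanned_by I g"
  shows "(\<lambda>x. \<Sum>j\<in>J. f j x) \<in> spanned_by I g"
proof -
  have "\<forall>j\<in>J. \<exists>c. \<forall>x. f j x = (\<Sum>i\<in>I. c i * g i x)"
    using assms by (simp add: spanned_by_def)
  then obtain c where "\<And>j x. j \<in> J \<Longrightarrow> f j x = (\<Sum>i\<in>I. c j i * g i x)"
    by metis
  then have "(\<Sum>j\<in>J. f j x) = (\<Sum>i\<in>I. (\<Sum>j\<in>J. c j i) * g i x)" for x
    by (simp add: sum_distrib_right sum.swap[of _ I J])
  then show ?thesis by (rule spanned_byI)
qed

lemma spanned_by_combination:
  assumes "\<And>j. j \<in> J \<Longrightarrow> f j \<in> spanned_by I g"
  shows "(\<lambda>x. \<Sum>j\<in>J. c j * f j x) \<in> spanned_by I g"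
  using assms by (intro spanned_by_sum spanned_by_scale)

section \<open>Powers of a scalar from shifted \<open>k\<close>-th powers\<close>

text \<open>The weights invert a Vandermonde matrix: \<open>c b\<close> is the coefficient of degree
  \<open>q\<close> in the Lagrange basis polynomial at \<open>b\<close>. Comparing coefficients in
  the interpolation of the \<open>m\<close>-th power gives the claim.\<close>

lemma moment_dual:
  fixes B :: "real set"
  assumes "finite B" "card B = Suc k"
  shows "\<exists>c. \<forall>m\<le>k. (\<Sum>b\<in>B. c b * b ^ m) = of_bool (m = q)"
proof -
  define L where "L b = (\<Prod>y\<in>B - {b}. smult (1 / (b - y)) [:- y, 1:])" for b
  have poly_L: "poly (L b) x = of_bool (x = b)" if "b \<in> B" "x \<in> B" for b x
  proof (cases "x = b")
    case True
    then have "poly (L b) x = (\<Prod>y\<in>B - {b}. 1)"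
      unfolding L_def poly_prod by (intro prod.cong) (auto simp: diff_divide_distrib[symmetric])
    with True show ?thesis by simp
  next
    case False
    then show ?thesis unfolding L_def poly_prod
      using assms that by (auto simp: intro!: bexI[of _ x])
  qed
  have degree_L: "degree (L b) \<le> k" if "b \<in> B" for b
  proof -
    have "degree (L b) \<le> (\<Sum>y\<in>B - {b}. degree (smult (1 / (b - y)) [:- y, 1:]))"
      unfolding L_def using assms by (intro degree_prod_sum_le[unfolded comp_def]) auto
    also have "\<dots> \<le> (\<Sum>y\<in>B - {b}. 1)" by (intro sum_mono) auto
    also have "\<dots> = k" using assms that by simp
    finally show ?thesis .
  qed
  \<comment> \<open>Interpolation is exact here: both sides have degree at most \<open>k\<close> and
    agree at \<open>k + 1\<close> points.\<close>
  have interp: "monom 1 m = (\<Sum>b\<in>B. smult (b ^ m) (L b))" if "m \<le> k" for m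
  proof (rule poly_eqI_degree[where A = B])
    show "poly (monom 1 m) x = poly (\<Sum>b\<in>B. smult (b ^ m) (L b)) x" if "x \<in> B" for x
      using that assms by (simp add: poly_sum poly_monom poly_L)
    show "card B > degree (monom (1::real) m)"
      using that assms by (simp add: degree_monom_eq)
    have "degree (\<Sum>b\<in>B. smult (b ^ m) (L b)) \<le> k"
      using degree_L by (intro degree_sum_le assms) (auto intro: order_trans[OF degree_smult_le])
    then show "card B > degree (\<Sum>b\<in>B. smult (b ^ m) (L b))"
      using assms by simp
  qed
  have "(\<Sum>b\<in>B. coeff (L b) q * b ^ m) = of_bool (m = q)" if "m \<le> k" for m
    using arg_cong[OF interp[OF that], of "\<lambda>p. coeff p q", symmetric]
    by (simp add: coeff_sum mult.commute of_bool_def del: sum_of_bool_eq)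
  then show ?thesis by (intro exI[of _ "\<lambda>b. coeff (L b) q"]) simp
qed

text \<open>In the binomial expansion of \<open>(t - b) ^ k\<close> the offset enters the term of
  degree \<open>j\<close> only through \<open>b ^ (k - j)\<close>. Weights that kill every moment of
  order at most \<open>k\<close> other than \<open>k - l\<close> therefore leave a nonzero multiple
  of \<open>t ^ l\<close>.\<close>

lemma power_in_span_shifted_powers:
  fixes B :: "real set"
  assumes "finite B" "card B = Suc k" "l \<le> k"
  shows "(\<lambda>t. t ^ l) \<in> spanned_by B (\<lambda>b t. (t - b) ^ k)"
proof -
  obtain c where c: "\<And>m. m \<le> k \<Longrightarrow> (\<Sum>b\<in>B. c b * b ^ m) = of_bool (m = k - l)"
    using moment_dual[OF assms(1,2), of "k - l"] by blast
  define r where "r = real (k choose l) * (- 1) ^ (k - l)"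
  have r: "r \<noteq> 0" using assms by (simp add: r_def)
  have "(\<Sum>b\<in>B. c b * (t - b) ^ k) = r * t ^ l" for t
  proof -
    have "(\<Sum>b\<in>B. c b * (t - b) ^ k) =
        (\<Sum>b\<in>B. \<Sum>j\<le>k. (real (k choose j) * t ^ j * (- 1) ^ (k - j)) * (c b * b ^ (k - j)))"
    proof (intro sum.cong refl)
      fix b
      have "(t - b) ^ k = (\<Sum>j\<le>k. real (k choose j) * t ^ j * (- b) ^ (k - j))"
        using binomial_ring[of t "- b" k] by simp
      also have "\<dots> = (\<Sum>j\<le>k. real (k choose j) * t ^ j * (- 1) ^ (k - j) * b ^ (k - j))"
        by (intro sum.cong refl) (simp add: power_minus[of b])
      finally show "c b * (t - b) ^ k =
          (\<Sum>j\<le>k. (real (k choose j) * t ^ j * (- 1) ^ (k - j)) * (c b * b ^ (k - j)))"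
        by (simp add: sum_distrib_left mult_ac)
    qed
    also have "\<dots> = (\<Sum>j\<le>k. (real (k choose j) * t ^ j * (- 1) ^ (k - j)) *
        (\<Sum>b\<in>B. c b * b ^ (k - j)))"
      by (subst sum.swap) (simp add: sum_distrib_left)
    also have "\<dots> = (\<Sum>j\<le>k. (real (k choose j) * t ^ j * (- 1) ^ (k - j)) * of_bool (j = l))"
      using assms(3) by (intro sum.cong refl) (auto simp: c)
    also have "\<dots> = r * t ^ l" using assms(3) by (simp add: r_def)
    finally show ?thesis .
  qed
  with r have "t ^ l = (\<Sum>b\<in>B. (c b / r) * (t - b) ^ k)" for t
    by (simp add: sum_divide_distrib[symmetric])
  then show ?thesis by (rule spanned_byI)
qed

section \<open>Polarization of monomials\<close>

lemma sum_Pow_insert: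
  assumes "finite S" "s \<notin> S"
  shows "(\<Sum>T\<in>Pow (insert s S). F T) = (\<Sum>T\<in>Pow S. F T + F (insert s T))"
proof -
  have "inj_on (insert s) (Pow S)" using assms by (auto simp: inj_on_def)
  moreover have "Pow S \<inter> insert s ` Pow S = {}" using assms by auto
  ultimately show ?thesis
    using assms by (simp add: Pow_insert sum.union_disjoint sum.reindex sum.distrib)
qed

text \<open>
  The left-hand side is an iterated finite difference of \<open>t ^ m\<close>, with one step \<open>y s\<close> for each
  \<open>s \<in> S\<close>; it kills the powers below \<open>card S\<close>.
\<close>
lemma polarization_diff:
  fixes y :: "'s \<Rightarrow> real"
  assumes "finite S" "m \<le> card S"
  shows "(\<Sum>T\<in>Pow S. (- 1) ^ card (S - T) * (z + sum y T) ^ m) =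
    of_bool (m = card S) * fact m * (\<Prod>s\<in>S. y s)"
  using assms
proof (induction S arbitrary: m z)
  case empty
  then show ?case by simp
next
  case (insert s S)
  \<comment> \<open>A difference in the step \<open>y s\<close> lowers the degree, so the induction
    hypothesis covers every remaining power.\<close>
  have step: "(w + y s) ^ m - w ^ m = (\<Sum>j<m. real (m choose j) * y s ^ (m - j) * w ^ j)" for w
  proof -
    have "(w + y s) ^ m = (\<Sum>j\<le>m. real (m choose j) * y s ^ (m - j) * w ^ j)"
      by (simp add: binomial_ring mult_ac)
    then show ?thesis by (simp add: lessThan_Suc_atMost[symmetric])
  qed
  \<comment> \<open>Pair \<open>T\<close> with \<open>insert s T\<close>: the two signs are
    opposite, which turns each pair into a difference in the step \<open>y s\<close>.\<close>
  have "(\<Sum>T\<in>Pow (insert s S). (- 1) ^ card (insert s S - T) * (z + sum y T) ^ m) =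
      (\<Sum>T\<in>Pow S. (- 1) ^ card (S - T) * ((z + sum y T + y s) ^ m - (z + sum y T) ^ m))"
    unfolding sum_Pow_insert[OF insert.hyps(1,2)]
  proof (intro sum.cong refl)
    fix T assume T: "T \<in> Pow S"
    then have "finite T" "s \<notin> T" using insert.hyps finite_subset by auto
    moreover from T insert.hyps have "insert s S - T = insert s (S - T)"
      "insert s S - insert s T = S - T" by auto
    ultimately show "(- 1) ^ card (insert s S - T) * (z + sum y T) ^ m +
        (- 1) ^ card (insert s S - insert s T) * (z + sum y (insert s T)) ^ m =
        (- 1) ^ card (S - T) * ((z + sum y T + y s) ^ m - (z + sum y T) ^ m)"
      using insert.hyps by (simp add: algebra_simps)
  qed
  also have "\<dots> = (\<Sum>j<m. real (m choose j) * y s ^ (m - j) *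
      (\<Sum>T\<in>Pow S. (- 1) ^ card (S - T) * (z + sum y T) ^ j))"
    unfolding step sum_distrib_left by (subst sum.swap) (simp add: mult_ac)
  also have "\<dots> = (\<Sum>j<m. real (m choose j) * y s ^ (m - j) *
      (of_bool (j = card S) * fact j * (\<Prod>s\<in>S. y s)))"
    using insert.prems insert.hyps by (intro sum.cong refl) (subst insert.IH; simp)
  \<comment> \<open>Only \<open>j = card S\<close> can survive, and it occurs only if
    \<open>m\<close> is \<open>card S + 1\<close>; the binomial coefficient is then \<open>m\<close>
    and lifts \<open>fact (card S)\<close> to \<open>fact m\<close>.\<close>
  also have "\<dots> = of_bool (m = card (insert s S)) * fact m * (\<Prod>s\<in>insert s S. y s)"
  proof (cases "m = Suc (card S)")
    case True
    then have "m choose card S = m" by (simp add: Suc_times_binomial_eq)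
    with True insert.hyps show ?thesis by (simp add: mult_ac)
  next
    case False
    with insert.prems insert.hyps have "m \<le> card S" by simp
    then show ?thesis using insert.hyps False by (auto intro!: sum.neutral)
  qed
  finally show ?case .
qed

text \<open>A monomial is a product of coordinates with repetitions, and polarization turns such a
  product into powers of its subset sums. Each subset sum is the inner product of \<open>x\<close>
  with a multi-index bounded by \<alpha>, so one finite set of directions serves all
  monomials.\<close>

lemma monomial_in_span_powers:
  fixes \<alpha> :: "'n::finite \<Rightarrow> nat"
  assumes "\<alpha> \<in> multi_indices k"
  shows "(\<lambda>x::real^'n. \<Prod>i\<in>UNIV. (x $ i) ^ \<alpha> i) \<in>
    spanned_by (multi_indices k) (\<lambda>v x. ((\<chi> i. real (v i)) \<bullet> x) ^ (\<Sum>i\<in>UNIV. \<alpha> i))"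
    (is "_ \<in> spanned_by _ ?g")
proof -
  \<comment> \<open>\<open>S\<close> holds one copy of coordinate \<open>i\<close> for each of its
    \<open>\<alpha> i\<close> occurrences, and \<open>v T\<close> counts the copies that
    \<open>T\<close> selects.\<close>
  define S where "S = (SIGMA i:(UNIV::'n set). {..<\<alpha> i})"
  have S: "finite S" "card S = (\<Sum>i\<in>UNIV. \<alpha> i)" by (simp_all add: S_def)
  define v where "v T i = card {q. (i, q) \<in> T}" for T :: "('n \<times> nat) set" and i
  have fibre: "T = (SIGMA i:UNIV. {q. (i, q) \<in> T})" "finite {q. (i, q) \<in> T}"
    if "T \<in> Pow S" for T i
  proof -
    show "T = (SIGMA i:UNIV. {q. (i, q) \<in> T})" by auto
    have "{q. (i, q) \<in> T} \<subseteq> {..<\<alpha> i}" using that by (auto simp: S_def)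
    then show "finite {q. (i, q) \<in> T}" by (rule finite_subset) simp
  qed
  have v: "v T \<in> multi_indices k" if "T \<in> Pow S" for T
  proof -
    have "v T i \<le> \<alpha> i" for i
    proof -
      have "{q. (i, q) \<in> T} \<subseteq> {..<\<alpha> i}" using that by (auto simp: S_def)
      from card_mono[OF _ this] show ?thesis by (simp add: v_def)
    qed
    then have "(\<Sum>i\<in>UNIV. v T i) \<le> (\<Sum>i\<in>UNIV. \<alpha> i)" by (intro sum_mono)
    with assms show ?thesis by (simp add: multi_indices_def)
  qed
  have inner: "(\<Sum>p\<in>T. x $ fst p) = (\<chi> i. real (v T i)) \<bullet> x" if "T \<in> Pow S" for T and x :: "real^'n"
  proof -
    have "(\<Sum>p\<in>T. x $ fst p) = (\<Sum>p\<in>(SIGMA i:UNIV. {q. (i, q) \<in> T}). x $ fst p)"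
      using fibre(1)[OF that] by simp
    also have "\<dots> = (\<Sum>i\<in>UNIV. \<Sum>q\<in>{q. (i, q) \<in> T}. x $ i)"
      using fibre(2)[OF that] by (subst sum.Sigma) (auto simp: case_prod_unfold)
    finally show ?thesis by (simp add: inner_vec_def v_def)
  qed
  define l where "l = (\<Sum>i\<in>UNIV. \<alpha> i)"
  have "(\<Prod>i\<in>UNIV. (x $ i) ^ \<alpha> i) =
      (\<Sum>T\<in>Pow S. ((- 1) ^ card (S - T) / fact l) * ?g (v T) x)" for x
  proof -
    have "(\<Sum>T\<in>Pow S. (- 1) ^ card (S - T) * ?g (v T) x) =
        (\<Sum>T\<in>Pow S. (- 1) ^ card (S - T) * (0 + (\<Sum>p\<in>T. x $ fst p)) ^ l)"
      by (intro sum.cong refl) (simp add: inner l_def)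
    also have "\<dots> = fact l * (\<Prod>p\<in>S. x $ fst p)"
      using polarization_diff[OF S(1), of l 0 "\<lambda>p. x $ fst p"] S by (simp add: l_def)
    also have "(\<Prod>p\<in>S. x $ fst p) = (\<Prod>i\<in>UNIV. \<Prod>q<\<alpha> i. x $ i)"
      unfolding S_def by (subst prod.Sigma) (auto simp: case_prod_unfold)
    finally show ?thesis by (simp add: sum_divide_distrib[symmetric])
  qed
  \<comment> \<open>Distinct \<open>T\<close> may share the same \<open>v T\<close>, so closure of
    the span under combinations takes the place of a change of summation index.\<close>
  moreover have "(\<lambda>x. \<Sum>T\<in>Pow S. ((- 1) ^ card (S - T) / fact l) * ?g (v T) x) \<in>
      spanned_by (multi_indices k) ?g"
    using v by (intro spanned_by_combination spanned_by_generator finite_multi_indices)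
  ultimately show ?thesis by simp
qed

section \<open>Polynomials as combinations of ridge powers\<close>

text \<open>Asking only that multi-indices be multiples of the directions admits unit vectors: the
  factor \<open>r\<close> merely contributes \<open>r ^ l\<close>. For the zero multi-index
  \<open>r = 0\<close> permits any direction.\<close>

lemma polynomial_in_span_ridge_powers:
  fixes P :: "real^'n \<Rightarrow> real"
  assumes P: "P \<in> poly_space k"
    and B: "finite B" "card B = Suc k"
    and \<omega>: "\<And>v. v \<in> multi_indices k \<Longrightarrow> \<exists>r. (\<chi> i. real (v i)) = r *\<^sub>R \<omega> v"
  shows "P \<in> spanned_by (multi_indices k \<times> B) (\<lambda>(v, b) x. (\<omega> v \<bullet> x - b) ^ k)"
    (is "_ \<in> spanned_by ?I ?g")
proof -
  have I: "finite ?I" using B by (simp add: finite_multi_indices)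
  have ridge: "(\<lambda>x. (\<omega> v \<bullet> x) ^ l) \<in> spanned_by ?I ?g"
    if v: "v \<in> multi_indices k" and l: "l \<le> k" for v l
  proof -
    obtain c where "\<And>t. t ^ l = (\<Sum>b\<in>B. c b * (t - b) ^ k)"
      using power_in_span_shifted_powers[OF B l] unfolding spanned_by_def by auto
    then have "(\<lambda>x. (\<omega> v \<bullet> x) ^ l) = (\<lambda>x. \<Sum>b\<in>B. c b * ?g (v, b) x)"
      by simp
    also have "\<dots> \<in> spanned_by ?I ?g"
      using v by (intro spanned_by_combination spanned_by_generator I) auto
    finally show ?thesis .
  qed
  have mono: "(\<lambda>x. \<Prod>i\<in>UNIV. (x $ i) ^ \<alpha> i) \<in> spanned_by ?I ?g"
    if \<alpha>: "\<alpha> \<in> multi_indices k" for \<alpha> :: "'n \<Rightarrow> nat"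
  proof -
    define l where "l = (\<Sum>i\<in>UNIV. \<alpha> i)"
    have l: "l \<le> k" using \<alpha> by (simp add: l_def multi_indices_def)
    obtain c where c: "\<And>x::real^'n. (\<Prod>i\<in>UNIV. (x $ i) ^ \<alpha> i) =
        (\<Sum>v\<in>multi_indices k. c v * ((\<chi> i. real (v i)) \<bullet> x) ^ l)"
      using monomial_in_span_powers[OF \<alpha>] unfolding spanned_by_def l_def by auto
    have "(\<lambda>x. ((\<chi> i. real (v i)) \<bullet> x) ^ l) \<in> spanned_by ?I ?g"
      if v: "v \<in> multi_indices k" for v
    proof -
      obtain r where "(\<chi> i. real (v i)) = r *\<^sub>R \<omega> v" using \<omega>[OF v] by blast
      then have "(\<lambda>x. ((\<chi> i. real (v i)) \<bullet> x) ^ l) = (\<lambda>x. r ^ l * (\<omega> v \<bullet> x) ^ l)"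
        by (simp add: power_mult_distrib)
      with spanned_by_scale[OF ridge[OF v l]] show ?thesis by simp
    qed
    then show ?thesis unfolding c by (intro spanned_by_combination)
  qed
  obtain a where "\<And>x. P x = (\<Sum>\<alpha>\<in>multi_indices k. a \<alpha> * (\<Prod>i\<in>UNIV. (x $ i) ^ \<alpha> i))"
    using P unfolding poly_space_def by auto
  then have "P = (\<lambda>x. \<Sum>\<alpha>\<in>multi_indices k. a \<alpha> * (\<Prod>i\<in>UNIV. (x $ i) ^ \<alpha> i))" by auto
  also have "\<dots> \<in> spanned_by ?I ?g" using mono by (intro spanned_by_combination)
  finally show ?thesis .
qed

section \<open>Uniqueness of the coefficients of a polynomial\<close>

text \<open>Induction on the variables: with the others fixed, the sum is a polynomial in the new
  variable with infinitely many zeros, so its coefficients vanish. Exponents outside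
  \<open>S\<close> are invisible to the products, hence the conclusion can only concern the sum over
  all \<alpha> that agree with \<beta> on \<open>S\<close>.\<close>

lemma multivariate_coeffs_zero:
  fixes a :: "('n \<Rightarrow> nat) \<Rightarrow> real"
  assumes A: "finite A" and S: "finite S" and X: "\<And>i. infinite (X i)"
    and zero: "\<And>x. (\<And>i. x i \<in> X i) \<Longrightarrow> (\<Sum>\<alpha>\<in>A. a \<alpha> * (\<Prod>i\<in>S. x i ^ \<alpha> i)) = (0::real)"
  shows "(\<Sum>\<alpha>\<in>{\<alpha>\<in>A. \<forall>i\<in>S. \<alpha> i = \<beta> i}. a \<alpha>) = 0"
  using S zero
proof (induction S arbitrary: a)
  case empty
  have "\<exists>t. t \<in> X i" for i using infinite_imp_nonempty[OF X] by blast
  then obtain x where "\<And>i. x i \<in> X i" by metis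
  from empty(1)[OF this] show ?case by simp
next
  case (insert j S)
  obtain N where N: "\<And>\<alpha>. \<alpha> \<in> A \<Longrightarrow> \<alpha> j \<le> N"
    using finite_nat_set_iff_bounded_le[of "(\<lambda>\<alpha>. \<alpha> j) ` A"] A by auto
  \<comment> \<open>Exponent \<open>\<beta> j\<close> in the variable \<open>j\<close> is selected
    by zeroing the other coefficients, as the induction hypothesis is general in \<open>a\<close>.
    If \<open>\<beta> j\<close> exceeds the bound \<open>N\<close>, nothing is left.\<close>
  have "(\<Sum>\<alpha>\<in>A. (of_bool (\<alpha> j = \<beta> j) * a \<alpha>) * (\<Prod>i\<in>S. x i ^ \<alpha> i)) = 0"
    if x: "\<And>i. x i \<in> X i" for x
  proof (cases "\<beta> j \<le> N")
    case False
    then show ?thesis using N by (intro sum.neutral) fastforce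
  next
    case True
    \<comment> \<open>\<open>c l\<close> is the coefficient of \<open>t ^ l\<close> after
      \<open>x j\<close> is replaced by \<open>t\<close>.\<close>
    define c where "c l = (\<Sum>\<alpha>\<in>A. (of_bool (\<alpha> j = l) * a \<alpha>) * (\<Prod>i\<in>S. x i ^ \<alpha> i))" for l
    have "(\<Sum>l\<le>N. c l * t ^ l) = 0" if "t \<in> X j" for t
    proof -
      have "(\<Sum>l\<le>N. c l * t ^ l) =
          (\<Sum>\<alpha>\<in>A. \<Sum>l\<le>N. (a \<alpha> * (\<Prod>i\<in>S. x i ^ \<alpha> i)) * (of_bool (\<alpha> j = l) * t ^ l))"
        unfolding c_def sum_distrib_right by (subst sum.swap) (simp add: mult_ac)
      also have "\<dots> = (\<Sum>\<alpha>\<in>A. (a \<alpha> * (\<Prod>i\<in>S. x i ^ \<alpha> i)) * t ^ \<alpha> j)"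
        using N by (intro sum.cong refl) (auto simp: sum_distrib_left[symmetric] Int_def cong: conj_cong)
      also have "\<dots> = (\<Sum>\<alpha>\<in>A. a \<alpha> * (\<Prod>i\<in>insert j S. ((x(j := t)) i) ^ \<alpha> i))"
      proof (intro sum.cong refl)
        fix \<alpha>
        have "(\<Prod>i\<in>S. ((x(j := t)) i) ^ \<alpha> i) = (\<Prod>i\<in>S. x i ^ \<alpha> i)"
          using insert.hyps by (intro prod.cong) auto
        then show "(a \<alpha> * (\<Prod>i\<in>S. x i ^ \<alpha> i)) * t ^ \<alpha> j =
            a \<alpha> * (\<Prod>i\<in>insert j S. ((x(j := t)) i) ^ \<alpha> i)"
          using insert.hyps by simp
      qed
      also have "\<dots> = 0" using x that by (intro insert.prems) auto
      finally show ?thesis .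
    qed
    then have "X j \<subseteq> {t. (\<Sum>l\<le>N. c l * t ^ l) = 0}" by auto
    then have "infinite {t. (\<Sum>l\<le>N. c l * t ^ l) = 0}"
      using X[of j] finite_subset by blast
    with True have "c (\<beta> j) = 0" by (simp add: polyfun_finite_roots)
    then show ?thesis by (simp add: c_def)
  qed
  from insert.IH[OF this]
  have "(\<Sum>\<alpha>\<in>{\<alpha>\<in>A. \<forall>i\<in>S. \<alpha> i = \<beta> i}. of_bool (\<alpha> j = \<beta> j) * a \<alpha>) = 0" .
  moreover have "(\<Sum>\<alpha>\<in>{\<alpha>\<in>A. \<forall>i\<in>S. \<alpha> i = \<beta> i}. of_bool (\<alpha> j = \<beta> j) * a \<alpha>) =
      (\<Sum>\<alpha>\<in>{\<alpha>\<in>A. \<forall>i\<in>insert j S. \<alpha> i = \<beta> i}. a \<alpha>)"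
    using A by (intro sum.mono_neutral_cong_right) auto
  ultimately show ?case by simp
qed

text \<open>The edges of a box with nonempty interior are infinite sets, and once all variables are
  included only \<beta> itself agrees with \<beta>.\<close>

lemma multivariate_coeffs_zero_cbox:
  fixes a :: "('n::finite \<Rightarrow> nat) \<Rightarrow> real" and u v :: "real^'n"
  assumes A: "finite A" and box: "box u v \<noteq> {}"
    and zero: "\<And>x. x \<in> cbox u v \<Longrightarrow> (\<Sum>\<alpha>\<in>A. a \<alpha> * (\<Prod>i\<in>UNIV. (x $ i) ^ \<alpha> i)) = 0"
    and \<beta>: "\<beta> \<in> A"
  shows "a \<beta> = 0"
proof -
  have "(\<Sum>\<alpha>\<in>{\<alpha>\<in>A. \<forall>i\<in>UNIV. \<alpha> i = \<beta> i}. a \<alpha>) = 0"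
  proof (rule multivariate_coeffs_zero[OF A, where X = "\<lambda>i. {u $ i..v $ i}"])
    show "infinite {u $ i..v $ i}" for i
      using box by (simp add: interval_ne_empty_cart)
    show "(\<Sum>\<alpha>\<in>A. a \<alpha> * (\<Prod>i\<in>UNIV. x i ^ \<alpha> i)) = 0" if "\<And>i. x i \<in> {u $ i..v $ i}" for x
      using zero[of "\<chi> i. x i"] that by (simp add: mem_box_cart)
  qed simp
  moreover have "{\<alpha>\<in>A. \<forall>i\<in>UNIV. \<alpha> i = \<beta> i} = {\<beta>}" using \<beta> by auto
  ultimately show ?thesis by simp
qed

section \<open>Control of the coefficients by the norms on \<Omega>\<close>

text \<open>The form is homogeneous of degree two, so its positive minimum on the compact l1 unit
  sphere controls it everywhere by rescaling; the constant is the inverse square root of that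
  minimum.\<close>

lemma l1_le_sqrt_positive_form:
  fixes M :: "'i \<Rightarrow> 'i \<Rightarrow> real"
  assumes I: "finite I"
    and pos: "\<And>a. \<exists>i\<in>I. a i \<noteq> 0 \<Longrightarrow> (\<Sum>i\<in>I. \<Sum>j\<in>I. a i * a j * M i j) > 0"
  shows "\<exists>C\<ge>0. \<forall>a. (\<Sum>i\<in>I. \<bar>a i\<bar>) \<le> C * sqrt (\<Sum>i\<in>I. \<Sum>j\<in>I. a i * a j * M i j)"
proof (cases "I = {}")
  case True
  then show ?thesis by auto
next
  case False
  then obtain i0 where i0: "i0 \<in> I" by blast
  define Q where "Q a = (\<Sum>i\<in>I. \<Sum>j\<in>I. a i * a j * M i j)" for a
  \<comment> \<open>The index type may be infinite, so coordinates outside \<open>I\<close> are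
    pinned to 0; compactness of \<open>K\<close> is then Tychonoff's theorem.\<close>
  define K where "K = (\<Pi>\<^sub>E i\<in>UNIV. if i \<in> I then {- 1..1::real} else {0})"
  define S where "S = K \<inter> {a. (\<Sum>i\<in>I. \<bar>a i\<bar>) = 1}"
  have cont: "continuous_on UNIV (\<lambda>a::'i \<Rightarrow> real. a i)" for i
    by (rule continuous_on_product_coordinates)
  have "compactin (product_topology (\<lambda>i. euclidean) UNIV) K"
    unfolding K_def compactin_PiE by auto
  then have "compact K" by (simp add: euclidean_product_topology)
  moreover have "closed {a :: 'i \<Rightarrow> real. (\<Sum>i\<in>I. \<bar>a i\<bar>) = 1}"
    by (intro closed_Collect_eq continuous_intros cont)
  ultimately have "compact S" unfolding S_def by (rule compact_Int_closed)
  moreover have "(\<lambda>i. of_bool (i = i0)) \<in> S"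
    using i0 I by (auto simp: S_def K_def of_bool_def if_distrib cong: if_cong)
  then have "S \<noteq> {}" by blast
  moreover have "continuous_on S Q"
    unfolding Q_def using cont continuous_on_subset[OF cont subset_UNIV]
    by (intro continuous_intros)
  ultimately obtain a0 where a0: "a0 \<in> S" "\<And>a. a \<in> S \<Longrightarrow> Q a0 \<le> Q a"
    using continuous_attains_inf by metis
  have "\<exists>i\<in>I. a0 i \<noteq> 0"
  proof (rule ccontr)
    assume "\<not> ?thesis"
    then have "(\<Sum>i\<in>I. \<bar>a0 i\<bar>) = 0" by simp
    with a0(1) show False by (simp add: S_def)
  qed
  from pos[OF this] have q: "Q a0 > 0" by (simp add: Q_def)
  have "(\<Sum>i\<in>I. \<bar>a i\<bar>) \<le> 1 / sqrt (Q a0) * sqrt (Q a)" for a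
  proof -
    define s where "s = (\<Sum>i\<in>I. \<bar>a i\<bar>)"
    have s0: "s \<ge> 0" by (simp add: s_def sum_nonneg)
    have "s\<^sup>2 * Q a0 \<le> Q a"
    proof (cases "s = 0")
      case True
      then have "\<And>i. i \<in> I \<Longrightarrow> a i = 0" using I by (simp add: s_def sum_nonneg_eq_0_iff)
      then show ?thesis using True by (simp add: Q_def)
    next
      case False
      \<comment> \<open>Rescaling gives l1 norm one; the cutoff outside \<open>I\<close> places
        \<open>a'\<close> in \<open>S\<close> without affecting sums over \<open>I\<close>.\<close>
      define a' where "a' i = (if i \<in> I then a i / s else 0)" for i
      have "(\<Sum>i\<in>I. \<bar>a' i\<bar>) = (\<Sum>i\<in>I. \<bar>a i\<bar>) / s"
        using s0 by (simp add: a'_def sum_divide_distrib)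
      then have one: "(\<Sum>i\<in>I. \<bar>a' i\<bar>) = 1" using False by (simp add: s_def)
      have "\<bar>a' i\<bar> \<le> 1" if "i \<in> I" for i
        using member_le_sum[OF that, of "\<lambda>i. \<bar>a' i\<bar>"] I one by simp
      then have "- 1 \<le> a' i \<and> a' i \<le> 1" if "i \<in> I" for i
        using that by (simp add: abs_le_iff minus_le_iff)
      moreover have "a' i = 0" if "i \<notin> I" for i using that by (simp add: a'_def)
      ultimately have "a' \<in> S" using one by (simp add: S_def K_def PiE_def Pi_def)
      then have "Q a0 \<le> Q a'" by (rule a0)
      also have "Q a' = Q a / s\<^sup>2"
        unfolding Q_def sum_divide_distrib
        by (intro sum.cong refl) (simp add: a'_def power2_eq_square)
      finally show ?thesis using False by (simp add: field_simps)
    qed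
    then have "s * sqrt (Q a0) \<le> sqrt (Q a)"
      using real_sqrt_le_mono[of "s\<^sup>2 * Q a0" "Q a"] s0 by (simp add: real_sqrt_mult)
    then show ?thesis using q by (simp add: s_def field_simps)
  qed
  then show ?thesis unfolding Q_def[symmetric] using q by (intro exI[of _ "1 / sqrt (Q a0)"]) auto
qed

lemma set_integrable_continuous_bounded:
  fixes f :: "'a::euclidean_space \<Rightarrow> real"
  assumes "continuous_on UNIV f" "bounded S" "S \<in> sets borel"
  shows "set_integrable lborel S f"
proof (rule set_integrable_subset)
  show "set_integrable lborel (closure S) f"
    unfolding set_integrable_def using assms
    by (intro borel_integrable_compact) (auto intro: continuous_on_subset simp: compact_closure)
qed (use assms closure_subset in auto)

text \<open>The integral over \<open>S\<close> dominates the one over the closed box, where a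
  continuous nonnegative function with zero integral would vanish identically.\<close>

lemma set_integral_square_pos:
  fixes f :: "'a::euclidean_space \<Rightarrow> real"
  assumes f: "continuous_on UNIV f" and S: "bounded S" "open S"
    and box: "cbox u v \<subseteq> S" "box u v \<noteq> {}" and x: "x \<in> cbox u v" "f x \<noteq> 0"
  shows "(LINT x:S|lborel. (f x)\<^sup>2) > 0"
proof -
  have f2: "continuous_on UNIV (\<lambda>x. (f x)\<^sup>2)" using f by (intro continuous_intros)
  have int_S: "set_integrable lborel S (\<lambda>x. (f x)\<^sup>2)"
    using S by (intro set_integrable_continuous_bounded f2) auto
  have int_box: "set_integrable lborel (cbox u v) (\<lambda>x. (f x)\<^sup>2)"
    by (intro set_integrable_continuous_bounded f2) auto
  have "integral (cbox u v) (\<lambda>x. (f x)\<^sup>2) \<noteq> 0"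
    using x by (subst integral_cbox_eq_0_iff) (auto simp: box(2) intro: continuous_on_subset[OF f2])
  then have "(LINT x:cbox u v|lborel. (f x)\<^sup>2) \<noteq> 0"
    by (simp add: set_borel_integral_eq_integral(2)[OF int_box])
  moreover have "(LINT x:cbox u v|lborel. (f x)\<^sup>2) \<ge> 0"
    by (simp add: set_lebesgue_integral_def)
  moreover have "(LINT x:cbox u v|lborel. (f x)\<^sup>2) \<le> (LINT x:S|lborel. (f x)\<^sup>2)"
    unfolding set_lebesgue_integral_def
    using int_S int_box box(1) unfolding set_integrable_def
    by (intro integral_mono) (auto simp: indicator_def)
  ultimately show ?thesis by linarith
qed

text \<open>The squared L2 norm is the quadratic form of the Gram matrix \<open>M\<close>, and it is
  positive for nonzero coefficients because a polynomial vanishing on a box inside \<Omega> has only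
  zero coefficients.\<close>

lemma coeffs_le_L2_norm:
  fixes \<Omega> :: "(real^'n) set"
  assumes \<Omega>: "bounded \<Omega>" "open \<Omega>" "\<Omega> \<noteq> {}"
  shows "\<exists>C\<ge>0. \<forall>a. (\<Sum>\<alpha>\<in>multi_indices k. \<bar>a \<alpha>\<bar>) \<le>
    C * sqrt (LINT x:\<Omega>|lborel. (\<Sum>\<alpha>\<in>multi_indices k. a \<alpha> * (\<Prod>i\<in>UNIV. (x $ i) ^ \<alpha> i))\<^sup>2)"
proof -
  define mono where "mono \<alpha> x = (\<Prod>i\<in>UNIV. (x $ i) ^ \<alpha> i)" for \<alpha> :: "'n \<Rightarrow> nat" and x :: "real^'n"
  have cont: "continuous_on UNIV (mono \<alpha>)" for \<alpha>
    unfolding mono_def by (intro continuous_intros)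
  define M where "M \<alpha> \<beta> = (LINT x:\<Omega>|lborel. mono \<alpha> x * mono \<beta> x)" for \<alpha> \<beta>
  let ?I = "multi_indices k :: ('n \<Rightarrow> nat) set"
  have form: "(\<Sum>\<alpha>\<in>?I. \<Sum>\<beta>\<in>?I. a \<alpha> * a \<beta> * M \<alpha> \<beta>) =
      (LINT x:\<Omega>|lborel. (\<Sum>\<alpha>\<in>?I. a \<alpha> * mono \<alpha> x)\<^sup>2)" for a
  proof -
    have int: "set_integrable lborel \<Omega> (\<lambda>x. mono \<alpha> x * mono \<beta> x)" for \<alpha> \<beta>
      using \<Omega> by (intro set_integrable_continuous_bounded continuous_intros cont) auto
    have "(\<Sum>\<alpha>\<in>?I. a \<alpha> * mono \<alpha> x)\<^sup>2 =
        (\<Sum>\<alpha>\<in>?I. \<Sum>\<beta>\<in>?I. a \<alpha> * a \<beta> * (mono \<alpha> x * mono \<beta> x))" for x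
      by (simp add: power2_eq_square sum_product mult_ac)
    moreover have "integrable lborel (\<lambda>x. a \<alpha> * a \<beta> * (indicator \<Omega> x * (mono \<alpha> x * mono \<beta> x)))"
      for \<alpha> \<beta>
      using int[of \<alpha> \<beta>] by (simp add: set_integrable_def)
    \<comment> \<open>Scalars go under the integral, against the usual direction of simplification,
      so that both sides meet as double sums of integrals.\<close>
    moreover have "a \<alpha> * a \<beta> * (LINT x|lborel. indicator \<Omega> x * (mono \<alpha> x * mono \<beta> x)) =
        (LINT x|lborel. a \<alpha> * a \<beta> * (indicator \<Omega> x * (mono \<alpha> x * mono \<beta> x)))" for \<alpha> \<beta>
      by simp
    ultimately show ?thesis
      by (simp add: M_def set_lebesgue_integral_def sum_distrib_left mult.left_commute[of "indicator _ _"]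
          Bochner_Integration.integral_sum del: integral_mult_right_zero)
  qed
  obtain u v where box: "box u v \<noteq> {}" "cbox u v \<subseteq> \<Omega>"
  proof -
    from \<Omega> obtain p where "p \<in> \<Omega>" by blast
    with \<Omega>(2) obtain u v where "cbox u v \<subseteq> \<Omega>" "p \<in> box u v"
      by (rule open_contains_cbox)
    with that show ?thesis by blast
  qed
  have "\<exists>C\<ge>0. \<forall>a. (\<Sum>\<alpha>\<in>?I. \<bar>a \<alpha>\<bar>) \<le> C * sqrt (\<Sum>\<alpha>\<in>?I. \<Sum>\<beta>\<in>?I. a \<alpha> * a \<beta> * M \<alpha> \<beta>)"
  proof (rule l1_le_sqrt_positive_form[OF finite_multi_indices])
    fix a :: "_ \<Rightarrow> real" assume "\<exists>\<alpha>\<in>?I. a \<alpha> \<noteq> 0"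
    then obtain x where "x \<in> cbox u v" "(\<Sum>\<alpha>\<in>?I. a \<alpha> * mono \<alpha> x) \<noteq> 0"
      using multivariate_coeffs_zero_cbox[OF finite_multi_indices box(1), of a]
      unfolding mono_def by blast
    then show "(\<Sum>\<alpha>\<in>?I. \<Sum>\<beta>\<in>?I. a \<alpha> * a \<beta> * M \<alpha> \<beta>) > 0"
      unfolding form using \<Omega> box
      by (intro set_integral_square_pos[of _ _ u v x] continuous_intros cont) auto
  qed
  then show ?thesis unfolding form unfolding mono_def .
qed

text \<open>The zero multi-index has order at most \<open>m\<close> for every \<open>m\<close> and
  contributes the squared L2 norm. The other summands are integrals of squares, nonnegative even
  where a nonintegrable function yields the default value 0.\<close>

lemma L2_norm_le_sobolev_norm:
  fixes f :: "real^'n \<Rightarrow> real"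
  shows "sqrt (LINT x:\<Omega>|lborel. (f x)\<^sup>2) \<le> sobolev_norm m \<Omega> f"
proof -
  have "foldr (\<lambda>i. partial_deriv i ^^ 0) xs g = g" for xs :: "'n list" and g
    by (induction xs) auto
  then have "multi_deriv (\<lambda>_. 0) f = f" by (simp add: multi_deriv_def)
  then have "(LINT x:\<Omega>|lborel. (f x)\<^sup>2) = (LINT x:\<Omega>|lborel. \<bar>multi_deriv (\<lambda>_. 0) f x\<bar>\<^sup>2)"
    by simp
  also have "\<dots> \<le> (\<Sum>\<alpha>\<in>multi_indices m. LINT x:\<Omega>|lborel. \<bar>multi_deriv \<alpha> f x\<bar>\<^sup>2)"
    by (intro member_le_sum finite_multi_indices)
      (auto simp: multi_indices_def set_lebesgue_integral_def)
  finally show ?thesis unfolding sobolev_norm_def by (rule real_sqrt_le_mono)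
qed

section \<open>The network and its coefficient map\<close>

theorem lemma2p2:
  fixes \<Omega> :: "(real^'n) set" and k :: nat
  assumes "CARD('n) \<ge> 2"
    and "bounded_lipschitz_domain \<Omega>"
    and "k \<ge> 1"
  shows "\<exists>J::nat. \<forall>(b_minus::real) (b_plus::real) (m::nat).
     b_minus < (INF (x, w)\<in>\<Omega> \<times> sphere 0 1. w \<bullet> x) - 1 \<longrightarrow>
     b_plus > (SUP (x, w)\<in>\<Omega> \<times> sphere 0 1. w \<bullet> x) + 1 \<longrightarrow>
     m \<le> k \<longrightarrow>
     (\<exists>(\<omega> :: nat \<Rightarrow> real^'n) (b :: nat \<Rightarrow> real) (T :: (real^'n \<Rightarrow> real) \<Rightarrow> nat \<Rightarrow> real).
        (\<forall>j\<in>{1..J}. \<omega> j \<in> sphere 0 1 \<and> b j \<in> {b_minus..b_plus}) \<and>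
        linear_on_polys k J T \<and>
        (\<forall>P\<in>poly_space k. \<forall>x\<in>\<Omega>. P x = (\<Sum>j=1..J. T P j * relu_pow k (\<omega> j \<bullet> x - b j))) \<and>
        (\<exists>C. \<forall>P\<in>poly_space k. (\<Sum>j=1..J. \<bar>T P j\<bar>) \<le> C * sobolev_norm m \<Omega> P))"
proof -
  let ?A = "multi_indices k :: ('n \<Rightarrow> nat) set"
  let ?mono = "\<lambda>\<alpha> x. \<Prod>i\<in>UNIV. (x $ i) ^ \<alpha> i :: real"
  have \<Omega>: "bounded \<Omega>" "open \<Omega>" "\<Omega> \<noteq> {}"
    using assms(2) by (auto simp: bounded_lipschitz_domain_def)
  obtain R where R: "\<And>x. x \<in> \<Omega> \<Longrightarrow> norm x \<le> R" using \<Omega>(1) by (auto simp: bounded_iff)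
  have inner_bound: "\<bar>w \<bullet> x\<bar> \<le> R" if "x \<in> \<Omega>" "w \<in> sphere 0 1" for w x
    using Cauchy_Schwarz_ineq2[of w x] R[OF that(1)] that by simp
  let ?F = "(\<lambda>(x, w). w \<bullet> x) ` (\<Omega> \<times> sphere 0 1)"
  \<comment> \<open>Infimum and supremum over the reals bound the inner products only once the
    family is known to be bounded.\<close>
  have bdd: "bdd_below ?F" "bdd_above ?F"
    using inner_bound by (force intro: bdd_belowI[of _ "- R"], force intro: bdd_aboveI[of _ R])
  obtain C0 where C0: "C0 \<ge> 0" "\<And>a. (\<Sum>\<alpha>\<in>?A. \<bar>a \<alpha>\<bar>) \<le>
      C0 * sqrt (LINT x:\<Omega>|lborel. (\<Sum>\<alpha>\<in>?A. a \<alpha> * ?mono \<alpha> x)\<^sup>2)"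
    using coeffs_le_L2_norm[OF \<Omega>] by blast
  \<comment> \<open>Uniqueness makes the coefficients, which are picked by choice below, depend
    linearly on the polynomial.\<close>
  have unique: "a \<alpha> = a' \<alpha>" if "\<alpha> \<in> ?A"
    "\<And>x. (\<Sum>\<alpha>\<in>?A. a \<alpha> * ?mono \<alpha> x) = (\<Sum>\<alpha>\<in>?A. a' \<alpha> * ?mono \<alpha> x)" for a a' \<alpha>
  proof -
    have "(\<Sum>\<alpha>\<in>?A. (a \<alpha> - a' \<alpha>) * ?mono \<alpha> x) = 0" for x
      using that(2)[of x] by (simp add: left_diff_distrib sum_subtractf)
    moreover have "box (0::real^'n) 1 \<noteq> {}" by (simp add: interval_ne_empty_cart)
    ultimately show ?thesis
      using multivariate_coeffs_zero_cbox[OF finite_multi_indices _ _ that(1),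
          of "0::real^'n" 1 "\<lambda>\<alpha>. a \<alpha> - a' \<alpha>"] by simp
  qed
  have "\<exists>a. \<forall>P\<in>poly_space k. \<forall>x. P x = (\<Sum>\<alpha>\<in>?A. a P \<alpha> * ?mono \<alpha> x)"
    by (rule bchoice) (simp add: poly_space_def)
  then obtain a where a: "\<And>P x. P \<in> poly_space k \<Longrightarrow> P x = (\<Sum>\<alpha>\<in>?A. a P \<alpha> * ?mono \<alpha> x)"
    by blast
  have a_add: "a (\<lambda>x. P x + Q x) \<alpha> = a P \<alpha> + a Q \<alpha>"
    if PQ: "P \<in> poly_space k" "Q \<in> poly_space k" and "\<alpha> \<in> ?A" for P Q \<alpha>
  proof (rule unique[OF \<open>\<alpha> \<in> ?A\<close>])
    have eq: "P x + Q x = (\<Sum>\<alpha>\<in>?A. (a P \<alpha> + a Q \<alpha>) * ?mono \<alpha> x)" for x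
      using a[OF PQ(1), of x] a[OF PQ(2), of x] by (simp add: distrib_right sum.distrib)
    then have "(\<lambda>x. P x + Q x) \<in> poly_space k" unfolding poly_space_eq_spanned_by by (rule spanned_byI)
    from a[OF this] show "(\<Sum>\<alpha>\<in>?A. a (\<lambda>x. P x + Q x) \<alpha> * ?mono \<alpha> x) =
        (\<Sum>\<alpha>\<in>?A. (a P \<alpha> + a Q \<alpha>) * ?mono \<alpha> x)" for x
      using eq by (rule trans[OF sym])
  qed
  have a_scale: "a (\<lambda>x. s * P x) \<alpha> = s * a P \<alpha>"
    if P: "P \<in> poly_space k" and "\<alpha> \<in> ?A" for s P \<alpha>
  proof (rule unique[OF \<open>\<alpha> \<in> ?A\<close>])
    have eq: "s * P x = (\<Sum>\<alpha>\<in>?A. (s * a P \<alpha>) * ?mono \<alpha> x)" for x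
      using a[OF P, of x] by (simp add: sum_distrib_left mult.assoc)
    then have "(\<lambda>x. s * P x) \<in> poly_space k" unfolding poly_space_eq_spanned_by by (rule spanned_byI)
    from a[OF this] show "(\<Sum>\<alpha>\<in>?A. a (\<lambda>x. s * P x) \<alpha> * ?mono \<alpha> x) =
        (\<Sum>\<alpha>\<in>?A. (s * a P \<alpha>) * ?mono \<alpha> x)" for x
      using eq by (rule trans[OF sym])
  qed
  \<comment> \<open>One neuron for each pair of a multi-index and an offset; this number is fixed
    before the interval and \<open>m\<close> are given.\<close>
  define J where "J = card ?A * Suc k"
  show ?thesis
  proof (intro exI[of _ J] allI impI)
    fix b_minus b_plus :: real and m :: nat
    assume b_minus: "b_minus < (INF (x, w)\<in>\<Omega> \<times> sphere 0 1. w \<bullet> x) - 1"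
      and b_plus: "b_plus > (SUP (x, w)\<in>\<Omega> \<times> sphere 0 1. w \<bullet> x) + 1"
    have above: "b_minus + 1 < w \<bullet> x" "w \<bullet> x < b_plus" if "x \<in> \<Omega>" "w \<in> sphere 0 1" for x w
    proof -
      have "(INF (x, w)\<in>\<Omega> \<times> sphere 0 1. w \<bullet> x) \<le> w \<bullet> x"
        using cINF_lower[OF bdd(1), of "(x, w)"] that by simp
      with b_minus show "b_minus + 1 < w \<bullet> x" by linarith
      have "w \<bullet> x \<le> (SUP (x, w)\<in>\<Omega> \<times> sphere 0 1. w \<bullet> x)"
        using cSUP_upper[OF _ bdd(2), of "(x, w)"] that by simp
      with b_plus show "w \<bullet> x < b_plus" by linarith
    qed
    \<comment> \<open>An arbitrary unit vector stands in for the direction of the zero multi-index,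
      which cannot be normalized.\<close>
    define e :: "real^'n" where "e = axis (SOME i. True) 1"
    have e: "norm e = 1" by (simp add: e_def)
    define vec where "vec v = (\<chi> i. real (v i))" for v :: "'n \<Rightarrow> nat"
    define \<omega> where "\<omega> v = (if vec v = 0 then e else vec v /\<^sub>R norm (vec v))" for v
    have \<omega>_sphere: "\<omega> v \<in> sphere 0 1" for v using e by (simp add: \<omega>_def)
    have \<omega>_scale: "\<exists>r. vec v = r *\<^sub>R \<omega> v" for v
      by (rule exI[of _ "norm (vec v)"]) (simp add: \<omega>_def)
    \<comment> \<open>Spacing \<open>1 / (k + 1)\<close> keeps all \<open>k + 1\<close> offsets
      within distance 1 above \<open>b_minus\<close>, hence below every value
      \<open>w \<bullet> x\<close>, so the truncation is inactive on \<Omega>.\<close>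
    define B where "B = (\<lambda>i. b_minus + real i / real (Suc k)) ` {..k}"
    have "inj_on (\<lambda>i. b_minus + real i / real (Suc k)) {..k}"
      by (auto simp: inj_on_def)
    then have B: "finite B" "card B = Suc k" by (simp_all add: B_def card_image)
    have B_bounds: "b_minus \<le> b" "b \<le> b_minus + 1" if "b \<in> B" for b
      using that by (auto simp: B_def)
    have "card (?A \<times> B) = J" by (simp add: J_def B(2) card_cartesian_product)
    then obtain g where g: "bij_betw g {1..J} (?A \<times> B)"
      using B ex_bij_betw_nat_finite_1[of "?A \<times> B"] by (auto simp: finite_multi_indices)
    have g_mem: "g j \<in> ?A \<times> B" if "j \<in> {1..J}" for j
      using g that by (rule bij_betw_apply)
    have "\<exists>c. \<forall>\<alpha>\<in>?A. \<forall>x. ?mono \<alpha> x = (\<Sum>(v, b)\<in>?A \<times> B. c \<alpha> (v, b) * (\<omega> v \<bullet> x - b) ^ k)"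
    proof (rule bchoice, rule ballI)
      fix \<alpha> assume "\<alpha> \<in> ?A"
      then have "?mono \<alpha> \<in> poly_space k"
        unfolding poly_space_eq_spanned_by by (intro spanned_by_generator finite_multi_indices)
      then have "?mono \<alpha> \<in> spanned_by (?A \<times> B) (\<lambda>(v, b) x. (\<omega> v \<bullet> x - b) ^ k)"
        using \<omega>_scale unfolding vec_def by (intro polynomial_in_span_ridge_powers B)
      then show "\<exists>c. \<forall>x. ?mono \<alpha> x = (\<Sum>(v, b)\<in>?A \<times> B. c (v, b) * (\<omega> v \<bullet> x - b) ^ k)"
        by (simp add: spanned_by_def case_prod_unfold)
    qed
    then obtain c where c: "\<And>\<alpha> x. \<alpha> \<in> ?A \<Longrightarrow>
        ?mono \<alpha> x = (\<Sum>(v, b)\<in>?A \<times> B. c \<alpha> (v, b) * (\<omega> v \<bullet> x - b) ^ k)"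
      by blast
    \<comment> \<open>\<open>T\<close> applies a fixed matrix to the coefficients of
      \<open>P\<close>; \<open>K\<close>, the sum of the absolute values of all its entries, bounds
      it from l1 to l1.\<close>
    define T where "T P j = (\<Sum>\<alpha>\<in>?A. a P \<alpha> * c \<alpha> (g j))" for P j
    define K where "K = (\<Sum>j=1..J. \<Sum>\<alpha>\<in>?A. \<bar>c \<alpha> (g j)\<bar>)"
    \<comment> \<open>Any point of \<Omega> shows that the interval is longer than 1, so it contains
      the offsets.\<close>
    have params: "\<omega> (fst (g j)) \<in> sphere 0 1 \<and> snd (g j) \<in> {b_minus..b_plus}" if "j \<in> {1..J}" for j
    proof -
      obtain x where "x \<in> \<Omega>" using \<Omega> by blast
      from above[OF this \<omega>_sphere[of "fst (g j)"]] have "b_minus + 1 < b_plus" by linarith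
      with B_bounds[of "snd (g j)"] g_mem[OF that] \<omega>_sphere show ?thesis by auto
    qed
    have linear: "linear_on_polys k J T"
      unfolding linear_on_polys_def T_def sum.distrib[symmetric] sum_distrib_left
      by (intro conjI ballI allI sum.cong refl) (simp_all add: a_add a_scale distrib_right)
    have repr: "P x = (\<Sum>j=1..J. T P j * relu_pow k (\<omega> (fst (g j)) \<bullet> x - snd (g j)))"
      if P: "P \<in> poly_space k" and x: "x \<in> \<Omega>" for P x
    proof -
      have relu: "relu_pow k (\<omega> v \<bullet> x - b) = (\<omega> v \<bullet> x - b) ^ k" if "b \<in> B" for v b
        using above(1)[OF x \<omega>_sphere, of v] B_bounds(2)[OF that] by (simp add: relu_pow_def)
      have "P x = (\<Sum>\<alpha>\<in>?A. \<Sum>p\<in>?A \<times> B. a P \<alpha> * c \<alpha> p * (\<omega> (fst p) \<bullet> x - snd p) ^ k)"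
        unfolding a[OF P, of x]
        by (intro sum.cong refl) (simp add: c sum_distrib_left case_prod_unfold mult.assoc)
      also have "\<dots> = (\<Sum>p\<in>?A \<times> B. (\<Sum>\<alpha>\<in>?A. a P \<alpha> * c \<alpha> p) * (\<omega> (fst p) \<bullet> x - snd p) ^ k)"
        by (subst sum.swap) (simp add: sum_distrib_right)
      also have "\<dots> = (\<Sum>p\<in>?A \<times> B. (\<Sum>\<alpha>\<in>?A. a P \<alpha> * c \<alpha> p) * relu_pow k (\<omega> (fst p) \<bullet> x - snd p))"
        by (intro sum.cong refl) (auto simp: relu)
      also have "\<dots> = (\<Sum>j=1..J. T P j * relu_pow k (\<omega> (fst (g j)) \<bullet> x - snd (g j)))"
        unfolding T_def by (rule sum.reindex_bij_betw[OF g, symmetric])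
      finally show ?thesis .
    qed
    have bound: "(\<Sum>j=1..J. \<bar>T P j\<bar>) \<le> (K * C0) * sobolev_norm m \<Omega> P"
      if P: "P \<in> poly_space k" for P
    proof -
      have K: "K \<ge> 0" by (simp add: K_def sum_nonneg)
      have "(\<Sum>j=1..J. \<bar>T P j\<bar>) \<le> (\<Sum>j=1..J. \<Sum>\<alpha>\<in>?A. \<bar>c \<alpha> (g j)\<bar> * (\<Sum>\<alpha>\<in>?A. \<bar>a P \<alpha>\<bar>))"
      proof (intro sum_mono)
        fix j
        have "\<bar>T P j\<bar> \<le> (\<Sum>\<alpha>\<in>?A. \<bar>a P \<alpha> * c \<alpha> (g j)\<bar>)" unfolding T_def by (rule sum_abs)
        also have "\<dots> \<le> (\<Sum>\<alpha>\<in>?A. \<bar>c \<alpha> (g j)\<bar> * (\<Sum>\<alpha>\<in>?A. \<bar>a P \<alpha>\<bar>))"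
        proof (intro sum_mono)
          fix \<alpha> assume "\<alpha> \<in> ?A"
          then have "\<bar>a P \<alpha>\<bar> \<le> (\<Sum>\<alpha>\<in>?A. \<bar>a P \<alpha>\<bar>)"
            by (intro member_le_sum) (auto simp: finite_multi_indices)
          then show "\<bar>a P \<alpha> * c \<alpha> (g j)\<bar> \<le> \<bar>c \<alpha> (g j)\<bar> * (\<Sum>\<alpha>\<in>?A. \<bar>a P \<alpha>\<bar>)"
            unfolding abs_mult mult.commute[of "\<bar>a P \<alpha>\<bar>"] by (rule mult_left_mono) simp
        qed
        finally show "\<bar>T P j\<bar> \<le> (\<Sum>\<alpha>\<in>?A. \<bar>c \<alpha> (g j)\<bar> * (\<Sum>\<alpha>\<in>?A. \<bar>a P \<alpha>\<bar>))" .
      qed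
      also have "\<dots> = K * (\<Sum>\<alpha>\<in>?A. \<bar>a P \<alpha>\<bar>)" by (simp add: K_def sum_distrib_right)
      \<comment> \<open>The bound \<open>C0\<close> is applied to \<open>a P\<close>, whose
        combination of monomials folds back to \<open>P\<close>.\<close>
      also have "\<dots> \<le> K * (C0 * sqrt (LINT x:\<Omega>|lborel. (P x)\<^sup>2))"
        using C0(2)[of "a P"] unfolding a[OF P, symmetric] by (intro mult_left_mono K)
      also have "\<dots> \<le> K * (C0 * sobolev_norm m \<Omega> P)"
        using K C0(1) by (intro mult_left_mono L2_norm_le_sobolev_norm)
      finally show ?thesis by (simp add: mult.assoc)
    qed
    show "\<exists>(\<omega> :: nat \<Rightarrow> real^'n) (b :: nat \<Rightarrow> real) (T :: (real^'n \<Rightarrow> real) \<Rightarrow> nat \<Rightarrow> real).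
        (\<forall>j\<in>{1..J}. \<omega> j \<in> sphere 0 1 \<and> b j \<in> {b_minus..b_plus}) \<and>
        linear_on_polys k J T \<and>
        (\<forall>P\<in>poly_space k. \<forall>x\<in>\<Omega>. P x = (\<Sum>j=1..J. T P j * relu_pow k (\<omega> j \<bullet> x - b j))) \<and>
        (\<exists>C. \<forall>P\<in>poly_space k. (\<Sum>j=1..J. \<bar>T P j\<bar>) \<le> C * sobolev_norm m \<Omega> P)"
      using params linear repr bound
      by (intro exI[of _ "\<lambda>j. \<omega> (fst (g j))"] exI[of _ "\<lambda>j. snd (g j)"] exI[of _ T]
          exI[of _ "K * C0"] conjI ballI) simp_all
  qed
qed

end
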